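(* Let $f(X)=a_nX^n+\cdots+a_1X+a_0$ be a polynomial with real coefficients, with $n\ge 1$ and $a_n>0$. Denote by $j_1<j_2<\cdots<j_\ell$ the indices $j$ for which $a_j<0$, and by $k_1<k_2<\cdots<k_t=n$ the indices $k>j_\ell$ for which $a_k>0$. Assume that $t\ge 2$ and let $$v=\max\left\{1,\ \max_{1\le i\le \ell}\left(\frac{|a_{j_1}+a_{j_2}+\cdots+a_{j_\ell}|}{a_{k_1}+a_{k_2}+\cdots+a_{k_t}}\right)^{\frac{1}{k_1-j_i}}\right\}.$$ Then $f$ has no zero in the sector $S_{v,\frac{\pi}{n}}$.
   Context: For real numbers $v,\theta$ with $0<\theta\le\pi$, define the open sector $S_{v,\theta}=\{z=v+\rho e^{i\varphi}\in\mathbb{C}:\rho>0,\ |\varphi|<\theta\}$ (with $\varphi$ real). If $f$ has no negative coefficients ($\ell=0$), the condition $k>j_\ell$ is void and the inner maximum over the empty set is understood to be $0$, i.e. $v=1$. *)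

theory Defs
  imports Complex_Main "HOL-Computational_Algebra.Polynomial"
begin

definition sector :: "real \<Rightarrow> real \<Rightarrow> complex set" where
  "sector v \<theta> = {z. \<exists>\<rho> \<phi>. \<rho> > 0 \<and> \<bar>\<phi>\<bar> < \<theta> \<and> z = complex_of_real v + rcis \<rho> \<phi>}"

definition neg_indices :: "real poly \<Rightarrow> nat set" where
  "neg_indices f = {j. coeff f j < 0}"

text \<open>
  The indices of the positive coefficients above all negative ones. If there are no negative
  coefficients, the first condition is void and all indices of positive coefficients, possibly
  including 0, are collected.
\<close>

definition top_pos_indices :: "real poly \<Rightarrow> nat set" where
  "top_pos_indices f = {k. (\<forall>j\<in>neg_indices f. j < k) \<and> coeff f k > 0}"

text \<open>
  The inner maximum over the empty set is understood to be 0; this has to be spelled out, since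
  \<^const>\<open>Max\<close> is unspecified there. The subtraction in the exponent is one of real numbers.
\<close>

definition sector_vertex :: "real poly \<Rightarrow> real" where
  "sector_vertex f =
     (let J = neg_indices f; K = top_pos_indices f; k\<^sub>1 = Min K in
      max 1 (if J = {} then 0
             else Max ((\<lambda>j. (\<bar>\<Sum>i\<in>J. coeff f i\<bar> / (\<Sum>k\<in>K. coeff f k))
                              powr (1 / (real k\<^sub>1 - real j))) ` J)))"

end

theory Submission
  imports Defs
begin

text \<open>
  The Taylor coefficients of \<open>f\<close> at \<open>v\<close> are all nonnegative: since \<open>v \<ge> 1\<close>, the coefficients of
  index in \<open>K\<close> contribute to the one of order \<open>m\<close> at least \<open>(\<Sum>k\<in>K. a\<^sub>k) * (k\<^sub>1 choose m) * v^(k\<^sub>1 - m)\<close>,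
  which by the choice of \<open>v\<close> outweighs the negative coefficients.
  Hence \<open>f (v + \<rho> e\<^sup>i\<^sup>\<phi>) = (\<Sum>m\<le>n. c\<^sub>m \<rho>\<^sup>m e\<^sup>i\<^sup>m\<^sup>\<phi>)\<close> with \<open>c\<^sub>m \<ge> 0\<close>, and for \<open>0 < \<bar>\<phi>\<bar> < \<pi>/n\<close> the
  imaginary parts of the summands all have the sign of \<open>\<phi>\<close>.
\<close>

lemma sum_rcis_nonneg_coeffs_neq_0:
  fixes c :: "nat \<Rightarrow> real"
  assumes "\<And>m. m \<le> n \<Longrightarrow> c m \<ge> 0" "c n > 0" "n \<ge> 1" "\<rho> > 0" "\<bar>\<phi>\<bar> < pi / real n"
  shows "(\<Sum>m\<le>n. complex_of_real (c m) * rcis \<rho> \<phi> ^ m) \<noteq> 0"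
proof (cases "\<phi> = 0")
  case True
  \<comment> \<open>On the ray \<open>\<phi> = 0\<close> all imaginary parts vanish, so the real
    part is used instead.\<close>
  have "0 < (\<Sum>m\<le>n. c m * \<rho> ^ m)"
    by (rule sum_pos2[where i = n]) (use assms in auto)
  then have "0 < Re (\<Sum>m\<le>n. complex_of_real (c m) * rcis \<rho> \<phi> ^ m)"
    using True by (simp add: DeMoivre2)
  then show ?thesis
    by (metis less_irrefl zero_complex.sel(1))
next
  case False
  have range: "real m * \<bar>\<phi>\<bar> < pi" if "m \<le> n" for m
  proof -
    have "real m * \<bar>\<phi>\<bar> \<le> real n * \<bar>\<phi>\<bar>"
      using that by (intro mult_right_mono) auto
    also have "\<dots> < pi"
      using assms by (simp add: field_simps)
    finally show ?thesis .
  qed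
  have "0 < (\<Sum>m\<le>n. c m * (\<rho> ^ m * sin (real m * \<bar>\<phi>\<bar>)))"
  proof (rule sum_pos2[where i = n])
    show "0 < c n * (\<rho> ^ n * sin (real n * \<bar>\<phi>\<bar>))"
      using assms False range[of n] by (intro mult_pos_pos sin_gt_zero) auto
    show "0 \<le> c m * (\<rho> ^ m * sin (real m * \<bar>\<phi>\<bar>))" if "m \<in> {..n}" for m
      using assms(1)[of m] assms(4) range[of m] that
      by (intro mult_nonneg_nonneg sin_ge_zero) auto
  qed auto
  \<comment> \<open>Since sine is odd, factoring out \<open>sgn \<phi>\<close> treats both
    half-planes at once.\<close>
  moreover have "Im (\<Sum>m\<le>n. complex_of_real (c m) * rcis \<rho> \<phi> ^ m)
      = sgn \<phi> * (\<Sum>m\<le>n. c m * (\<rho> ^ m * sin (real m * \<bar>\<phi>\<bar>)))"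
    by (cases "\<phi> > 0")
      (use False in \<open>simp_all add: DeMoivre2 sum_negf[symmetric] abs_if\<close>)
  ultimately have "Im (\<Sum>m\<le>n. complex_of_real (c m) * rcis \<rho> \<phi> ^ m) \<noteq> 0"
    using False by (simp add: sgn_zero_iff)
  then show ?thesis
    by (metis zero_complex.sel(2))
qed

text \<open>Letting both indices run up to \<open>n\<close> allows the sums to be swapped; the added
  terms with \<open>k < m\<close> vanish with their binomial coefficients.\<close>

lemma poly_add_eq_sum_binomial:
  fixes p :: "'a::comm_ring_1 poly"
  defines "n \<equiv> degree p"
  shows "poly p (x + y) =
    (\<Sum>m\<le>n. (\<Sum>k\<le>n. coeff p k * of_nat (k choose m) * x ^ (k - m)) * y ^ m)"
proof -
  have "(x + y) ^ k = (\<Sum>m\<le>n. of_nat (k choose m) * y ^ m * x ^ (k - m))" if "k \<le> n" for k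
    unfolding add.commute[of x y] binomial_ring
    by (rule sum.mono_neutral_left) (use that in \<open>auto simp: binomial_eq_0 not_le\<close>)
  then have "poly p (x + y) =
      (\<Sum>k\<le>n. \<Sum>m\<le>n. coeff p k * of_nat (k choose m) * x ^ (k - m) * y ^ m)"
    unfolding poly_altdef n_def[symmetric]
    by (simp add: sum_distrib_left mult_ac)
  then show ?thesis
    by (subst (asm) sum.swap) (simp add: sum_distrib_right)
qed

text \<open>The sum over \<open>K\<close> is at least \<open>B * C\<close>, and the negative terms
  total at most \<open>B * C\<close> in absolute value. Assumption \<open>dom\<close> is the lower
  bound on \<open>v\<close> with the roots cleared.\<close>

lemma sum_choose_power_nonneg:
  fixes a :: "nat \<Rightarrow> real"
  assumes fin: "finite I" and J: "J = {i \<in> I. a i < 0}" and K: "K \<subseteq> {i \<in> I. a i > 0}"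
    and k0: "\<And>k. k \<in> K \<Longrightarrow> k0 \<le> k" and jk: "\<And>j. j \<in> J \<Longrightarrow> j < k0"
    and v: "v \<ge> 1"
    and dom: "\<And>j. j \<in> J \<Longrightarrow> \<bar>\<Sum>i\<in>J. a i\<bar> \<le> (\<Sum>k\<in>K. a k) * v ^ (k0 - j)"
  shows "0 \<le> (\<Sum>i\<in>I. a i * real (i choose m) * v ^ (i - m))"
proof -
  define A where "A = (\<Sum>j\<in>J. - a j)"
  define B where "B = (\<Sum>k\<in>K. a k)"
  define C where "C = real (k0 choose m) * v ^ (k0 - m)"
  let ?g = "\<lambda>i. a i * real (i choose m) * v ^ (i - m)"
  have finJ: "finite J" and finK: "finite K"
    using fin J K by (auto intro: finite_subset)
  have B0: "B \<ge> 0" and C0: "C \<ge> 0"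
    using K v by (auto simp: B_def C_def intro!: sum_nonneg)
  have pos: "B * C \<le> sum ?g K"
    unfolding B_def sum_distrib_right
  proof (rule sum_mono)
    fix k assume k: "k \<in> K"
    have "C \<le> real (k choose m) * v ^ (k - m)"
      unfolding C_def using k0[OF k] v
      by (intro mult_mono power_increasing) (auto intro!: binomial_right_mono)
    then show "a k * C \<le> ?g k"
      using k K by (auto simp: mult.assoc)
  qed
  have neg: "(\<Sum>j\<in>J. - ?g j) \<le> B * C"
  proof (cases "J = {}")
    case False
    have A0: "A > 0"
      unfolding A_def using False finJ J by (intro sum_pos) auto
    \<comment> \<open>The bound \<open>B * C / A\<close> is the same for every \<open>j\<close>, so
      the weights \<open>- a j\<close> add up to \<open>A\<close>, which cancels.\<close>
    have "(\<Sum>j\<in>J. - ?g j) \<le> (\<Sum>j\<in>J. - a j * (B * C / A))"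
    proof (rule sum_mono)
      fix j assume j: "j \<in> J"
      have "real (j choose m) * v ^ (j - m) \<le> B * C / A"
      \<comment> \<open>For \<open>m \<le> j\<close>, multiplying \<open>dom\<close> by
        \<open>v ^ (j - m)\<close> raises the exponent to \<open>k0 - m\<close>. For
        \<open>m > j\<close> the subtraction truncates, but the binomial coefficient is 0.\<close>
      proof (cases "m \<le> j")
        case True
        have "A \<le> B * v ^ (k0 - j)"
          using dom[OF j] by (simp add: A_def B_def sum_negf)
        then have "A * v ^ (j - m) \<le> B * v ^ (k0 - j) * v ^ (j - m)"
          using v by (intro mult_right_mono) auto
        also have "\<dots> = B * v ^ (k0 - m)"
          using True jk[OF j] by (simp add: mult.assoc flip: power_add)
        finally have "real (j choose m) * (A * v ^ (j - m)) \<le> real (k0 choose m) * (B * v ^ (k0 - m))"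
          using jk[OF j] A0 v by (intro mult_mono[OF _ _ of_nat_0_le_iff]) (simp_all add: binomial_right_mono)
        then show ?thesis
          using A0 by (simp add: C_def field_simps)
      qed (use A0 B0 C0 in \<open>auto simp: binomial_eq_0\<close>)
      then have "- a j * (real (j choose m) * v ^ (j - m)) \<le> - a j * (B * C / A)"
        using j J by (intro mult_left_mono) auto
      then show "- ?g j \<le> - a j * (B * C / A)"
        by (simp add: mult.assoc)
    qed
    also have "\<dots> = A * (B * C / A)"
      unfolding A_def sum_distrib_right ..
    finally show ?thesis
      using A0 by simp
  qed (use B0 C0 in simp)
  have "0 \<le> sum ?g J + sum ?g K"
    using pos neg by (simp add: sum_negf)
  also have "\<dots> = sum ?g (J \<union> K)"
    using J K finJ finK by (subst sum.union_disjoint) auto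
  \<comment> \<open>Outside \<open>J \<union> K\<close> the coefficients are nonnegative.\<close>
  also have "\<dots> \<le> sum ?g I"
    using J K fin v by (intro sum_mono2) (auto intro!: mult_nonneg_nonneg)
  finally show ?thesis .
qed

theorem theorem2p9:
  fixes f :: "real poly" and n :: nat
  assumes "degree f = n"
    and "n \<ge> 1"
    and "coeff f n > 0"
    and "card (top_pos_indices f) \<ge> 2"
  shows "\<not> (\<exists>z \<in> sector (sector_vertex f) (pi / real n). poly (map_poly complex_of_real f) z = 0)"
proof -
  define J where "J = neg_indices f"
  define K where "K = top_pos_indices f"
  define v where "v = sector_vertex f"
  define c where "c m = (\<Sum>i\<le>n. coeff f i * real (i choose m) * v ^ (i - m))" for m
  have J: "J = {i \<in> {..n}. coeff f i < 0}"
    using assms(1) by (auto simp: J_def neg_indices_def intro: le_degree)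
  have K: "K \<subseteq> {i \<in> {..n}. coeff f i > 0}"
    using assms(1) by (auto simp: K_def top_pos_indices_def intro: le_degree)
  have finJ: "finite J" and finK: "finite K"
    using J K by (auto intro: finite_subset)
  have Kne: "K \<noteq> {}"
    using assms(4) by (auto simp: K_def)
  have k0: "Min K \<le> k" if "k \<in> K" for k
    using finK that by simp
  have jk: "j < Min K" if "j \<in> J" for j
    using Min_in[OF finK Kne] that by (auto simp: K_def J_def top_pos_indices_def)
  have v_eq: "v = max 1 (if J = {} then 0
      else Max ((\<lambda>j. (\<bar>\<Sum>i\<in>J. coeff f i\<bar> / (\<Sum>k\<in>K. coeff f k))
        powr (1 / (real (Min K) - real j))) ` J))"
    by (simp add: v_def sector_vertex_def Let_def J_def K_def)
  then have v1: "v \<ge> 1"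
    by simp
  have B0: "(\<Sum>k\<in>K. coeff f k) > 0"
    using finK Kne K by (intro sum_pos) auto
  have dom: "\<bar>\<Sum>i\<in>J. coeff f i\<bar> \<le> (\<Sum>k\<in>K. coeff f k) * v ^ (Min K - j)" if "j \<in> J" for j
  proof -
    define q where "q = \<bar>\<Sum>i\<in>J. coeff f i\<bar> / (\<Sum>k\<in>K. coeff f k)"
    define d where "d = Min K - j"
    \<comment> \<open>As \<open>j < Min K\<close>, the natural subtraction agrees with the real one
      in the exponent defining \<open>v\<close>.\<close>
    have d: "d > 0" "real d = real (Min K) - real j"
      using jk[OF that] by (auto simp: d_def)
    have "q powr (1 / d) \<le> v"
      unfolding v_eq q_def d(2) using that finJ by (auto intro!: max.coboundedI2 Max_ge)
    then have "(q powr (1 / d)) ^ d \<le> v ^ d"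
      by (intro power_mono) auto
    \<comment> \<open>For \<open>q = 0\<close>, \<open>powr\<close> yields 0, and
      \<open>d > 0\<close> keeps the power 0.\<close>
    moreover have "(q powr (1 / d)) ^ d = q"
      using d(1) B0 by (cases "q = 0") (auto simp: powr_power q_def)
    ultimately have "q \<le> v ^ d"
      by simp
    then show ?thesis
      using B0 by (simp add: q_def d_def field_simps)
  qed
  have c_nonneg: "c m \<ge> 0" for m
    unfolding c_def by (rule sum_choose_power_nonneg[OF _ J K k0 jk v1 dom]) auto
  \<comment> \<open>Only \<open>i = n\<close> survives, so the top Taylor coefficient is the leading
    coefficient of \<open>f\<close>.\<close>
  have "c n = (\<Sum>i\<in>{n}. coeff f i * real (i choose n) * v ^ (i - n))"
    unfolding c_def by (rule sum.mono_neutral_right) (auto simp: binomial_eq_0)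
  then have c_n: "c n > 0"
    using assms(3) by simp
  have "poly (map_poly complex_of_real f) (complex_of_real v + w) =
      (\<Sum>m\<le>n. complex_of_real (c m) * w ^ m)" for w
    using assms(1)
    by (simp add: poly_add_eq_sum_binomial c_def coeff_map_poly degree_map_poly)
  then show ?thesis
    using sum_rcis_nonneg_coeffs_neq_0[where c = c, OF c_nonneg c_n assms(2)]
    by (auto simp: sector_def v_def)
qed

end
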